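(* Let $u$ be a smooth function on $\bar\Omega$ (with bounded derivatives), and let $\mathcal D_{ww}u(x_0)$ be the second derivative scheme, for a unit vector $w\in\mathbb R^n$ and a point $x_0\in\mathcal G$, built from admissible simplices $\mathcal S_p,\mathcal S_m$ for parameters $h$ and $d\theta$ (all defined in the context). Asymptotics are as $h\to0$, and the constants in $\mathcal O(\cdot)$ may depend on $u$ and $n$ but not on $h$, $x_0$, $w$ or the choice of admissible simplices. (i) On a general (non-symmetric) stencil, with the choice $d\theta=\left(\frac h2\right)^{1/3}$ (optimal in the sense that it minimizes $\frac{h}{d\theta}+d\theta^2$ over $d\theta>0$), the scheme is consistent, with $$\left|\mathcal D_{ww}u(x_0)-w^{\mathsf T}D^2u(x_0)\,w\right|=\mathcal O\!\left(h^{2/3}\right).$$ (ii) On a symmetric stencil, with the choice $d\theta=h^{1/2}$ (optimal in the sense that it minimizes $\left(\frac{h}{d\theta}\right)^2+d\theta^2$ over $d\theta>0$), the scheme is consistent, with $$\left|\mathcal D_{ww}u(x_0)-w^{\mathsf T}D^2u(x_0)\,w\right|=\mathcal O(h).$$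
   Context: $n\in\{2,3\}$; $\Omega\subset\mathbb R^n$ is an open convex bounded domain with Lipschitz boundary; $\mathcal G\subset\bar\Omega$ is a finite point cloud with spatial resolution $h=\sup_{x\in\Omega}\min_{y\in\mathcal G}\|x-y\|$. Put $C_2=2$ and $C_3=1+\frac2{\sqrt3}$. For an angular resolution $0<d\theta<\pi$, the maximal and minimal search radii are $$R=C_nh\left(1+\operatorname{cosec}\tfrac{d\theta}2\right),\qquad r=C_nh\left(-1+\operatorname{cosec}\tfrac{d\theta}2\right).$$ Admissible simplices: $\mathcal S_p$ and $\mathcal S_m$ are sets of $n$ points of $\mathcal G$, each being the vertex set of an $(n-1)$-dimensional simplex. Every vertex $x_i$ of either satisfies $r\le\|x_i-x_0\|\le R$, and any two vertices of the same simplex are at distance at most $2C_nh$. The matrices $V_p$, $V_m$, whose columns are the vectors $x_i-x_0$ for $x_i\in\mathcal S_p$, respectively $x_i\in\mathcal S_m$, are invertible. There are $t_p,t_m\in[r,R]$ such that $x_0+t_pw$ lies in the convex hull of $\mathcal S_p$ and $x_0-t_mw$ lies in the convex hull of $\mathcal S_m$. Consequently $t_p=\frac1{\mathbf 1^{\mathsf T}V_p^{-1}w}$ and $t_m=\frac{-1}{\mathbf 1^{\mathsf T}V_m^{-1}w}$, where $\mathbf 1$ is the all-ones vector. Linear interpolants: $L_p(x)=\sum_{i\in\mathcal S_p}\lambda_p^i(x)u(x_i)$, where for $x$ in the simplex $\lambda_p(x)$ is the vector of barycentric coordinates, solving $V_p\lambda_p=x-x_0$; $L_m$ and $\lambda_m$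 are defined in the same way using $\mathcal S_m,V_m$. Schemes: $$\mathcal D_wu(x_0)=\frac{L_p(x_0+t_pw)-u(x_0)}{t_p},\qquad \mathcal D_{-w}u(x_0)=\frac{L_m(x_0-t_mw)-u(x_0)}{t_m},$$ $$\mathcal D_{ww}u(x_0)=\frac{2\left(\mathcal D_wu(x_0)+\mathcal D_{-w}u(x_0)\right)}{t_p+t_m}.$$ The stencil is symmetric if $\mathcal S_m$ is the reflection of $\mathcal S_p$ through $x_0$ (so $t_p=t_m$). $D^2u$ denotes the Hessian. *)

theory Defs
  imports "HOL-Analysis.Analysis"
begin

(* Near every boundary point, the set is the strict epigraph, over a hyperplane orthogonal to some
   unit vector e, of a Lipschitz function of the orthogonal projection. *)
definition lipschitz_boundary :: "(real^'n) set \<Rightarrow> bool" where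
  "lipschitz_boundary \<Omega> \<longleftrightarrow>
     (\<forall>p\<in>frontier \<Omega>. \<exists>e \<rho> L (\<phi> :: real^'n \<Rightarrow> real).
        norm e = 1 \<and> \<rho> > 0 \<and> L-lipschitz_on {y. y \<bullet> e = 0} \<phi> \<and>
        \<Omega> \<inter> ball p \<rho> = {x \<in> ball p \<rho>. \<phi> (x - (x \<bullet> e) *\<^sub>R e) < x \<bullet> e})"

(* Derivatives are taken within S, so that they also make sense at boundary points of a closed set.
   On the closure of a nonempty convex open set the derivative within the set is unique, and
   at interior points it is the ordinary one. *)
definition partial_within :: "(real^'n) set \<Rightarrow> 'n \<Rightarrow> (real^'n \<Rightarrow> real) \<Rightarrow> real^'n \<Rightarrow> real" where
  "partial_within S i f x = frechet_derivative f (at x within S) (axis i 1)"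

primrec Ck_bounded_on :: "nat \<Rightarrow> (real^'n) set \<Rightarrow> (real^'n \<Rightarrow> real) \<Rightarrow> bool" where
  "Ck_bounded_on 0 S f \<longleftrightarrow> continuous_on S f \<and> bounded (f ` S)"
| "Ck_bounded_on (Suc k) S f \<longleftrightarrow>
     f differentiable_on S \<and> bounded (f ` S) \<and> (\<forall>i. Ck_bounded_on k S (partial_within S i f))"

definition smooth_bounded_on :: "(real^'n) set \<Rightarrow> (real^'n \<Rightarrow> real) \<Rightarrow> bool" where
  "smooth_bounded_on S f \<longleftrightarrow> (\<forall>k. Ck_bounded_on k S f)"

definition hessian_within :: "(real^'n) set \<Rightarrow> (real^'n \<Rightarrow> real) \<Rightarrow> real^'n \<Rightarrow> real^'n^'n" where
  "hessian_within S f x = (\<chi> i j. partial_within S i (partial_within S j f) x)"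

definition resolution :: "(real^'n) set \<Rightarrow> (real^'n) set \<Rightarrow> real" where
  "resolution \<Omega> \<G> = (SUP x\<in>\<Omega>. Min ((\<lambda>y. norm (x - y)) ` \<G>))"

(* Only the dimensions 2 and 3 are used. *)
definition stencil_const :: "nat \<Rightarrow> real" where
  "stencil_const n = (if n = 2 then 2 else 1 + 2 / sqrt 3)"

definition max_radius :: "nat \<Rightarrow> real \<Rightarrow> real \<Rightarrow> real" where
  "max_radius n h d\<theta> = stencil_const n * h * (1 + 1 / sin (d\<theta> / 2))"

definition min_radius :: "nat \<Rightarrow> real \<Rightarrow> real \<Rightarrow> real" where
  "min_radius n h d\<theta> = stencil_const n * h * (-1 + 1 / sin (d\<theta> / 2))"

(* A simplex with n vertices in R^n is given by an enumeration X of its vertices, indexed by the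
   same type 'n as the coordinates; this also fixes the order of the columns. *)
definition vertex_matrix :: "real^'n \<Rightarrow> ('n \<Rightarrow> real^'n) \<Rightarrow> real^'n^'n" where
  "vertex_matrix x0 X = (\<chi> i j. (X j - x0) $ i)"

definition admissible_simplex ::
  "(real^'n) set \<Rightarrow> real \<Rightarrow> real \<Rightarrow> real^'n \<Rightarrow> ('n \<Rightarrow> real^'n) \<Rightarrow> bool" where
  "admissible_simplex \<G> h d\<theta> x0 X \<longleftrightarrow>
     range X \<subseteq> \<G> \<and> inj X \<and> \<not> affine_dependent (range X) \<and>
     (\<forall>i. min_radius CARD('n) h d\<theta> \<le> norm (X i - x0) \<and>
          norm (X i - x0) \<le> max_radius CARD('n) h d\<theta>) \<and>
     (\<forall>i j. norm (X i - X j) \<le> 2 * stencil_const CARD('n) * h) \<and>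
     invertible (vertex_matrix x0 X)"

definition barycentric :: "real^'n \<Rightarrow> ('n \<Rightarrow> real^'n) \<Rightarrow> real^'n \<Rightarrow> real^'n" where
  "barycentric x0 X x = matrix_inv (vertex_matrix x0 X) *v (x - x0)"

definition interpolant ::
  "(real^'n \<Rightarrow> real) \<Rightarrow> real^'n \<Rightarrow> ('n \<Rightarrow> real^'n) \<Rightarrow> real^'n \<Rightarrow> real" where
  "interpolant u x0 X x = (\<Sum>i\<in>UNIV. barycentric x0 X x $ i * u (X i))"

definition first_scheme ::
  "(real^'n \<Rightarrow> real) \<Rightarrow> real^'n \<Rightarrow> real^'n \<Rightarrow> ('n \<Rightarrow> real^'n) \<Rightarrow> real \<Rightarrow> real" where
  "first_scheme u x0 v X t = (interpolant u x0 X (x0 + t *\<^sub>R v) - u x0) / t"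

definition second_scheme ::
  "(real^'n \<Rightarrow> real) \<Rightarrow> real^'n \<Rightarrow> real^'n \<Rightarrow> ('n \<Rightarrow> real^'n) \<Rightarrow> ('n \<Rightarrow> real^'n) \<Rightarrow>
   real \<Rightarrow> real \<Rightarrow> real" where
  "second_scheme u x0 w Xp Xm tp tm =
     2 * (first_scheme u x0 w Xp tp + first_scheme u x0 (- w) Xm tm) / (tp + tm)"

definition stencil ::
  "(real^'n) set \<Rightarrow> (real^'n) set \<Rightarrow> real \<Rightarrow> real \<Rightarrow> real^'n \<Rightarrow> real^'n \<Rightarrow>
   ('n \<Rightarrow> real^'n) \<Rightarrow> ('n \<Rightarrow> real^'n) \<Rightarrow> real \<Rightarrow> real \<Rightarrow> bool" where
  "stencil \<Omega> \<G> h d\<theta> x0 w Xp Xm tp tm \<longleftrightarrow>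
     finite \<G> \<and> \<G> \<subseteq> closure \<Omega> \<and> h = resolution \<Omega> \<G> \<and> 0 < d\<theta> \<and> d\<theta> < pi \<and>
     x0 \<in> \<G> \<and> norm w = 1 \<and>
     admissible_simplex \<G> h d\<theta> x0 Xp \<and> admissible_simplex \<G> h d\<theta> x0 Xm \<and>
     tp \<in> {min_radius CARD('n) h d\<theta>..max_radius CARD('n) h d\<theta>} \<and>
     tm \<in> {min_radius CARD('n) h d\<theta>..max_radius CARD('n) h d\<theta>} \<and>
     x0 + tp *\<^sub>R w \<in> convex hull (range Xp) \<and>
     x0 - tm *\<^sub>R w \<in> convex hull (range Xm)"

definition symmetric_simplices ::
  "real^'n \<Rightarrow> ('n \<Rightarrow> real^'n) \<Rightarrow> ('n \<Rightarrow> real^'n) \<Rightarrow> bool" where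
  "symmetric_simplices x0 Xp Xm \<longleftrightarrow> range Xm = (\<lambda>x. 2 *\<^sub>R x0 - x) ` range Xp"

definition truncation_error ::
  "(real^'n) set \<Rightarrow> (real^'n \<Rightarrow> real) \<Rightarrow> real^'n \<Rightarrow> real^'n \<Rightarrow>
   ('n \<Rightarrow> real^'n) \<Rightarrow> ('n \<Rightarrow> real^'n) \<Rightarrow> real \<Rightarrow> real \<Rightarrow> real" where
  "truncation_error \<Omega> u x0 w Xp Xm tp tm =
     \<bar>second_scheme u x0 w Xp Xm tp tm - w \<bullet> (hessian_within (closure \<Omega>) u x0 *v w)\<bar>"

(* The angular resolution is a function \<theta> of the spatial resolution h. *)
definition general_errors ::
  "(real^'n) set \<Rightarrow> (real^'n \<Rightarrow> real) \<Rightarrow> (real \<Rightarrow> real) \<Rightarrow> real \<Rightarrow> real set" where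
  "general_errors \<Omega> u \<theta> h =
     {truncation_error \<Omega> u x0 w Xp Xm tp tm | \<G> x0 w Xp Xm tp tm.
        stencil \<Omega> \<G> h (\<theta> h) x0 w Xp Xm tp tm}"

definition symmetric_errors ::
  "(real^'n) set \<Rightarrow> (real^'n \<Rightarrow> real) \<Rightarrow> (real \<Rightarrow> real) \<Rightarrow> real \<Rightarrow> real set" where
  "symmetric_errors \<Omega> u \<theta> h =
     {truncation_error \<Omega> u x0 w Xp Xm tp tm | \<G> x0 w Xp Xm tp tm.
        stencil \<Omega> \<G> h (\<theta> h) x0 w Xp Xm tp tm \<and> symmetric_simplices x0 Xp Xm}"

(* E h is the set of all errors at resolution h, so both notions are uniform in the
   point cloud, the point x0, the direction w and the simplices. *)
definition consistent :: "(real \<Rightarrow> real set) \<Rightarrow> bool" where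
  "consistent E \<longleftrightarrow> (\<forall>\<epsilon>>0. \<forall>\<^sub>F h in at_right 0. \<forall>e\<in>E h. e < \<epsilon>)"

definition uniformly_bigo :: "(real \<Rightarrow> real set) \<Rightarrow> (real \<Rightarrow> real) \<Rightarrow> bool" where
  "uniformly_bigo E g \<longleftrightarrow> (\<exists>C. \<forall>\<^sub>F h in at_right 0. \<forall>e\<in>E h. e \<le> C * g h)"

end

theory Submission
  imports Defs
begin

text \<open>
  Write the vertices of a simplex as \<open>x0 + v\<^sub>i\<close>, let \<open>\<lambda>\<^sub>i\<close> be the barycentric coordinates of
  the point \<open>x0 + t w\<close>, and expand \<open>u (x0 + v\<^sub>i)\<close> to second order at \<open>x0\<close>, with remainder \<open>q (v\<^sub>i)\<close>.
  Since \<open>\<lambda>\<close> reproduces affine functions, the gradient contributes exactly \<open>t (\<nabla>u \<bullet> w)\<close>, and since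
  \<open>\<Sum>\<lambda>\<^sub>i v\<^sub>i = t w\<close>, the Hessian \<open>H\<close> satisfies the variance identity
  \<open>\<Sum>\<lambda>\<^sub>i (v\<^sub>i \<bullet> H v\<^sub>i) = t\<^sup>2 (w \<bullet> H w) + \<Sum>\<lambda>\<^sub>i ((v\<^sub>i - t w) \<bullet> H (v\<^sub>i - t w))\<close>. In the second difference scheme
  the gradient terms of the two simplices cancel and the terms \<open>t (w \<bullet> H w) / 2\<close> add up to
  \<open>w \<bullet> H w\<close>. What is left has two sources:

  \<^item> the spread of the vertices around \<open>x0 + t w\<close>; the simplices have diameter \<open>O(h)\<close>, so after
    division by two radii of order at least \<open>r\<close> this is \<open>O(h\<^sup>2 / r\<^sup>2)\<close>;
  \<^item> the remainders \<open>q\<close>, which are cubic and give \<open>O(R\<^sup>3 / r\<^sup>2)\<close>. On a symmetric stencil the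
    coordinates and the two distances \<open>t\<close> agree, so only \<open>q (v\<^sub>i) + q (- v\<^sub>i)\<close> matters. There the
    odd third order term drops out, and \<open>O(R\<^sup>4 / r\<^sup>2)\<close> remains.

  Both radii are comparable to \<open>h / d\<close> for the angular resolution \<open>d\<close> (\<open>radii_comparable\<close>), so the
  errors are \<open>O(d\<^sup>2 + h / d)\<close> and \<open>O(d\<^sup>2 + (h / d)\<^sup>2)\<close> respectively (\<open>general_truncation_error\<close>,
  \<open>symmetric_truncation_error\<close>). The two choices of \<open>d\<close> balance the summands.
\<close>

section \<open>Taylor expansion along segments\<close>

text \<open>
  The \<open>k\<close>-th derivative in direction \<open>v\<close>, expanded into iterated partial derivatives. The
  recursion takes partial derivatives of \<open>f\<close> first, as \<^const>\<open>Ck_bounded_on\<close> does, instead of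
  differentiating the sum obtained for \<open>k\<close>. In this way the partial derivative of a sum, as chosen by
  \<^const>\<open>frechet_derivative\<close>, never has to be compared with the sum of the partial derivatives.
\<close>

primrec directional ::
  "(real^'n) set \<Rightarrow> real^'n \<Rightarrow> nat \<Rightarrow> (real^'n \<Rightarrow> real) \<Rightarrow> real^'n \<Rightarrow> real" where
  "directional S v 0 f = f"
| "directional S v (Suc k) f = (\<lambda>x. \<Sum>i\<in>UNIV. v $ i * directional S v k (partial_within S i f) x)"

lemma has_derivative_along_segment:
  fixes f :: "real^'n \<Rightarrow> real"
  assumes "f differentiable_on S" and "(\<lambda>s. x + s *\<^sub>R v) ` T \<subseteq> S" and "s \<in> T"
  shows "((\<lambda>s. f (x + s *\<^sub>R v)) has_field_derivative
          (\<Sum>i\<in>UNIV. v $ i * partial_within S i f (x + s *\<^sub>R v))) (at s within T)"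
proof -
  let ?y = "x + s *\<^sub>R v"
  let ?F = "frechet_derivative f (at ?y within S)"
  have "?y \<in> S" using assms by blast
  then have F: "(f has_derivative ?F) (at ?y within S)"
    using assms(1) by (simp add: differentiable_on_def frechet_derivative_works)
  then have lin: "linear ?F" by (rule has_derivative_linear)
  have "((\<lambda>s. x + s *\<^sub>R v) has_derivative (\<lambda>d. d *\<^sub>R v)) (at s within T)"
    by (auto intro!: derivative_eq_intros)
  moreover have "(f has_derivative ?F) (at ?y within (\<lambda>s. x + s *\<^sub>R v) ` T)"
    using F assms(2) by (rule has_derivative_subset)
  ultimately have D: "((\<lambda>s. f (x + s *\<^sub>R v)) has_derivative (\<lambda>d. ?F (d *\<^sub>R v))) (at s within T)"
    by (rule has_derivative_in_compose)
  have "?F v = ?F (\<Sum>i\<in>UNIV. v $ i *\<^sub>R axis i 1)"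
    by (simp add: basis_expansion scalar_mult_eq_scaleR[symmetric])
  also have "\<dots> = (\<Sum>i\<in>UNIV. v $ i * ?F (axis i 1))"
    using lin by (simp add: linear_sum linear_cmul)
  finally have Fv: "?F v = (\<Sum>i\<in>UNIV. v $ i * partial_within S i f ?y)"
    by (simp add: partial_within_def)
  have "(\<lambda>d. ?F (d *\<^sub>R v)) = (*) (\<Sum>i\<in>UNIV. v $ i * partial_within S i f ?y)"
    using lin by (simp add: linear_cmul Fv mult.commute fun_eq_iff)
  with D show ?thesis by (simp add: has_field_derivative_def)
qed

lemma directional_has_derivative:
  fixes f :: "real^'n \<Rightarrow> real"
  assumes "Ck_bounded_on (Suc k) S f" and "(\<lambda>s. x + s *\<^sub>R v) ` T \<subseteq> S" and "s \<in> T"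
  shows "((\<lambda>s. directional S v k f (x + s *\<^sub>R v)) has_field_derivative
          directional S v (Suc k) f (x + s *\<^sub>R v)) (at s within T)"
  using assms(1)
proof (induction k arbitrary: f)
  case 0
  then show ?case
    using has_derivative_along_segment[OF _ assms(2,3), of f] by simp
next
  case (Suc k)
  have *: "((\<lambda>s. directional S v k (partial_within S i f) (x + s *\<^sub>R v)) has_field_derivative
          directional S v (Suc k) (partial_within S i f) (x + s *\<^sub>R v)) (at s within T)" for i
    using Suc.prems by (intro Suc.IH) auto
  show ?case
    unfolding directional.simps(2)[of S v "Suc k"] directional.simps(2)[of S v k f]
    by (intro DERIV_sum DERIV_cmult *)
qed

lemma directional_bound:
  assumes "Ck_bounded_on k S f"
  shows "\<exists>B\<ge>0. \<forall>v. \<forall>x\<in>S. \<bar>directional S v k f x\<bar> \<le> B * norm v ^ k"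
  using assms
proof (induction k arbitrary: f)
  case 0
  then obtain B where "\<forall>x\<in>S. \<bar>f x\<bar> \<le> B" by (auto simp: bounded_iff)
  then have "\<forall>x\<in>S. \<bar>f x\<bar> \<le> max B 0" by fastforce
  then show ?case by (intro exI[of _ "max B 0"]) simp
next
  case (Suc k)
  then have "\<forall>i. \<exists>B\<ge>0. \<forall>v. \<forall>x\<in>S. \<bar>directional S v k (partial_within S i f) x\<bar> \<le> B * norm v ^ k"
    by simp
  then obtain B where B: "\<And>i. B i \<ge> 0"
    "\<And>i v x. x \<in> S \<Longrightarrow> \<bar>directional S v k (partial_within S i f) x\<bar> \<le> B i * norm v ^ k"
    by metis
  show ?case
  proof (intro exI[of _ "\<Sum>i\<in>UNIV. B i"] conjI allI ballI)
    show "0 \<le> (\<Sum>i\<in>UNIV. B i)" using B by (simp add: sum_nonneg)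
    fix v x assume "x \<in> S"
    have "\<bar>directional S v (Suc k) f x\<bar>
        \<le> (\<Sum>i\<in>UNIV. \<bar>v $ i\<bar> * \<bar>directional S v k (partial_within S i f) x\<bar>)"
      by (simp add: sum_abs flip: abs_mult)
    also have "\<dots> \<le> (\<Sum>i\<in>UNIV. norm v * (B i * norm v ^ k))"
      using B \<open>x \<in> S\<close> by (intro sum_mono mult_mono component_le_norm_cart) auto
    also have "\<dots> = (\<Sum>i\<in>UNIV. B i) * norm v ^ Suc k"
      by (simp add: sum_distrib_right sum_distrib_left mult_ac)
    finally show "\<bar>directional S v (Suc k) f x\<bar> \<le> (\<Sum>i\<in>UNIV. B i) * norm v ^ Suc k" .
  qed
qed

lemma directional_minus: "directional S (- v) k f x = (-1) ^ k * directional S v k f x"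
  by (induction k arbitrary: f) (simp_all add: sum_distrib_left mult_ac sum_negf)

text \<open>
  This is the one-dimensional Taylor formula for \<open>s \<mapsto> f (x + s v)\<close> on \<open>[0, 1]\<close>. The one-sided
  derivatives at the end points of the interval are the ones that exist when \<open>x\<close> or \<open>x + v\<close> lies
  on the boundary of \<open>S\<close>.
\<close>

lemma directional_taylor:
  fixes f :: "real^'n \<Rightarrow> real"
  assumes "convex S" and "smooth_bounded_on S f"
  shows "\<exists>B\<ge>0. \<forall>x v. x \<in> S \<longrightarrow> x + v \<in> S \<longrightarrow>
    \<bar>f (x + v) - (\<Sum>k\<le>n. directional S v k f x / fact k)\<bar> \<le> B * norm v ^ Suc n"
proof -
  have C: "Ck_bounded_on k S f" for k using assms(2) by (simp add: smooth_bounded_on_def)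
  obtain B where B: "B \<ge> 0" "\<And>v x. x \<in> S \<Longrightarrow> \<bar>directional S v (Suc n) f x\<bar> \<le> B * norm v ^ Suc n"
    using directional_bound[OF C[of "Suc n"]] by blast
  show ?thesis
  proof (intro exI[of _ B] conjI allI impI)
    fix x v assume xv: "x \<in> S" "x + v \<in> S"
    have seg: "(\<lambda>s. x + s *\<^sub>R v) ` {0..1} \<subseteq> S"
    proof (clarify)
      fix s :: real assume "s \<in> {0..1}"
      then have "(1 - s) *\<^sub>R x + s *\<^sub>R (x + v) \<in> S"
        using assms(1) xv by (intro convexD) auto
      then show "x + s *\<^sub>R v \<in> S" by (simp add: algebra_simps)
    qed
    have "norm (directional S v 0 f (x + 1 *\<^sub>R v)
        - (\<Sum>i\<le>n. directional S v i f (x + 0 *\<^sub>R v) * (1 - 0) ^ i / fact i))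
      \<le> (B * norm v ^ Suc n) * norm (1 - 0 :: real) ^ Suc n / fact n"
    proof (rule field_Taylor[where S = "{0..1::real}"
          and f = "\<lambda>k s. directional S v k f (x + s *\<^sub>R v)"])
      show "((\<lambda>s. directional S v i f (x + s *\<^sub>R v)) has_field_derivative
          directional S v (Suc i) f (x + s *\<^sub>R v)) (at s within {0..1})"
        if "s \<in> {0..1}" for i and s :: real
        by (rule directional_has_derivative[OF C seg that])
      show "norm (directional S v (Suc n) f (x + s *\<^sub>R v)) \<le> B * norm v ^ Suc n"
        if "s \<in> {0..1}" for s :: real
        using B(2)[of "x + s *\<^sub>R v" v] seg that by (simp add: image_subset_iff del: directional.simps)
    qed auto
    also have "\<dots> \<le> B * norm v ^ Suc n"
      using B(1) frac_le[of "B * norm v ^ Suc n" "B * norm v ^ Suc n" 1 "fact n"] fact_ge_1[of n]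
      by (simp del: power_Suc)
    finally show "\<bar>f (x + v) - (\<Sum>k\<le>n. directional S v k f x / fact k)\<bar> \<le> B * norm v ^ Suc n"
      by simp
  qed (rule B(1))
qed

lemma directional_1: "directional S v 1 f x = v \<bullet> (\<chi> i. partial_within S i f x)"
  by (simp add: inner_vec_def)

lemma directional_2: "directional S v 2 f x = v \<bullet> (hessian_within S f x *v v)"
proof -
  have "directional S v 2 f x
      = (\<Sum>i\<in>UNIV. \<Sum>j\<in>UNIV. v $ i * (v $ j * partial_within S j (partial_within S i f) x))"
    by (simp add: numeral_2_eq_2 sum_distrib_left)
  also have "\<dots> = (\<Sum>j\<in>UNIV. \<Sum>i\<in>UNIV. v $ i * (v $ j * partial_within S j (partial_within S i f) x))"
    by (rule sum.swap)
  also have "\<dots> = v \<bullet> (hessian_within S f x *v v)"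
    by (simp add: inner_vec_def matrix_vector_mult_def hessian_within_def sum_distrib_left mult_ac)
  finally show ?thesis .
qed

definition quadratic_remainder ::
  "(real^'n) set \<Rightarrow> (real^'n \<Rightarrow> real) \<Rightarrow> real^'n \<Rightarrow> real^'n \<Rightarrow> real" where
  "quadratic_remainder S f x v =
     f (x + v) - f x - directional S v 1 f x - directional S v 2 f x / 2"

lemma quadratic_remainder_cubic_bound:
  assumes "convex S" and "smooth_bounded_on S f"
  shows "\<exists>B\<ge>0. \<forall>x v. x \<in> S \<longrightarrow> x + v \<in> S \<longrightarrow> \<bar>quadratic_remainder S f x v\<bar> \<le> B * norm v ^ 3"
  using directional_taylor[OF assms, of 2]
  by (simp add: quadratic_remainder_def numeral_2_eq_2 numeral_3_eq_3 algebra_simps)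

text \<open>
  Third derivatives are odd in the direction, so they cancel in the even part of the remainder.
\<close>

lemma quadratic_remainder_even_bound:
  assumes "convex S" and "smooth_bounded_on S f"
  shows "\<exists>B\<ge>0. \<forall>x v. x \<in> S \<longrightarrow> x + v \<in> S \<longrightarrow> x - v \<in> S \<longrightarrow>
    \<bar>quadratic_remainder S f x v + quadratic_remainder S f x (- v)\<bar> \<le> B * norm v ^ 4"
proof -
  obtain B where B: "B \<ge> 0" and taylor: "\<And>x v. x \<in> S \<Longrightarrow> x + v \<in> S \<Longrightarrow>
    \<bar>f (x + v) - (\<Sum>k\<le>3. directional S v k f x / fact k)\<bar> \<le> B * norm v ^ Suc 3"
    using directional_taylor[OF assms, of 3] by blast
  have tail: "f (x + v) - (\<Sum>k\<le>3. directional S v k f x / fact k)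
      = quadratic_remainder S f x v - directional S v 3 f x / 6" for x v
  proof -
    have "{..3::nat} = {0, 1, 2, 3}" by auto
    then show ?thesis
      by (simp add: quadratic_remainder_def fact_numeral del: directional.simps(2) One_nat_def)
  qed
  show ?thesis
  proof (intro exI[of _ "2 * B"] conjI allI impI)
    fix x v assume "x \<in> S" "x + v \<in> S" "x - v \<in> S"
    then have "\<bar>quadratic_remainder S f x v - directional S v 3 f x / 6\<bar> \<le> B * norm v ^ 4"
      "\<bar>quadratic_remainder S f x (- v) - directional S (- v) 3 f x / 6\<bar> \<le> B * norm v ^ 4"
      using taylor[of x v] taylor[of x "- v"] unfolding tail by simp_all
    then show "\<bar>quadratic_remainder S f x v + quadratic_remainder S f x (- v)\<bar> \<le> 2 * B * norm v ^ 4"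
      by (simp add: directional_minus)
  qed (use B in simp)
qed

section \<open>Interpolation on a simplex\<close>

lemma barycentric_unique:
  assumes "invertible (vertex_matrix x0 X)" and "(\<Sum>i\<in>UNIV. b $ i *\<^sub>R (X i - x0)) = x - x0"
  shows "barycentric x0 X x = b"
proof -
  have "vertex_matrix x0 X *v b = x - x0"
    unfolding assms(2)[symmetric]
    by (simp add: vec_eq_iff vertex_matrix_def matrix_vector_mult_def mult.commute)
  moreover have "matrix_inv (vertex_matrix x0 X) ** vertex_matrix x0 X = mat 1"
    using someI_ex[OF assms(1)[unfolded invertible_def]] by (simp add: matrix_inv_def)
  ultimately show ?thesis
    unfolding barycentric_def by (metis matrix_vector_mul_assoc matrix_vector_mul_lid)
qed

text \<open>
  The coefficients of \<open>x\<close> as a convex combination of the vertices solve the linear system that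
  defines \<^const>\<open>barycentric\<close>, and this system has only one solution. In general the coordinates
  defined by the system need not sum to 1; they do on the simplex.
\<close>

lemma barycentric_convex_hull:
  assumes "invertible (vertex_matrix x0 X)" and "inj X" and "x \<in> convex hull (range X)"
  shows "\<forall>i. barycentric x0 X x $ i \<ge> 0"
    and "(\<Sum>i\<in>UNIV. barycentric x0 X x $ i) = 1"
    and "(\<Sum>i\<in>UNIV. barycentric x0 X x $ i *\<^sub>R X i) = x"
proof -
  obtain c where c: "\<forall>y\<in>range X. 0 \<le> c y" "sum c (range X) = 1" "(\<Sum>y\<in>range X. c y *\<^sub>R y) = x"
    using assms(3) by (auto simp: convex_hull_finite)
  define b where "b = (\<chi> i. c (X i))"
  have b: "\<forall>i. b $ i \<ge> 0" "(\<Sum>i\<in>UNIV. b $ i) = 1" "(\<Sum>i\<in>UNIV. b $ i *\<^sub>R X i) = x"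
    using c by (simp_all add: b_def sum.reindex[OF assms(2)] o_def)
  then have "(\<Sum>i\<in>UNIV. b $ i *\<^sub>R (X i - x0)) = x - x0"
    by (simp add: scaleR_right_diff_distrib sum_subtractf flip: scaleR_left.sum)
  then have "barycentric x0 X x = b" by (rule barycentric_unique[OF assms(1)])
  with b show "\<forall>i. barycentric x0 X x $ i \<ge> 0" "(\<Sum>i\<in>UNIV. barycentric x0 X x $ i) = 1"
    "(\<Sum>i\<in>UNIV. barycentric x0 X x $ i *\<^sub>R X i) = x" by simp_all
qed

text \<open>
  The coordinates of \<open>x0 + t w\<close> are linear in \<open>t\<close>, and they have to sum to 1.
\<close>

lemma ray_parameter_unique:
  assumes "invertible (vertex_matrix x0 X)" and "inj X"
    and "x0 + s *\<^sub>R w \<in> convex hull (range X)" and "x0 + t *\<^sub>R w \<in> convex hull (range X)"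
  shows "s = t"
proof -
  define \<sigma> where "\<sigma> = (\<Sum>i\<in>UNIV. (matrix_inv (vertex_matrix x0 X) *v w) $ i)"
  have "q * \<sigma> = (\<Sum>i\<in>UNIV. barycentric x0 X (x0 + q *\<^sub>R w) $ i)" for q
    by (simp add: \<sigma>_def barycentric_def sum_distrib_left
        flip: scalar_mult_eq_scaleR add: vector_scalar_commute)
  then have "s * \<sigma> = 1" "t * \<sigma> = 1"
    using barycentric_convex_hull(2)[OF assms(1,2)] assms(3,4) by simp_all
  then show ?thesis by (metis mult_cancel_right zero_neq_one mult_zero_right)
qed

lemma weighted_average_bound:
  fixes b :: "real^'n"
  assumes "\<forall>i. b $ i \<ge> 0" and "(\<Sum>i\<in>UNIV. b $ i) = 1" and "\<And>i. \<bar>f i\<bar> \<le> M"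
  shows "\<bar>\<Sum>i\<in>UNIV. b $ i * f i\<bar> \<le> M"
proof -
  have "\<bar>\<Sum>i\<in>UNIV. b $ i * f i\<bar> \<le> (\<Sum>i\<in>UNIV. b $ i * M)"
    using assms by (intro order_trans[OF sum_abs] sum_mono) (simp add: abs_mult mult_left_mono)
  then show ?thesis using assms(2) by (simp flip: sum_distrib_right)
qed

lemma dist_vertex_convex_hull:
  assumes "\<And>j. norm (X i - X j) \<le> \<delta>" and "x \<in> convex hull (range X)"
  shows "norm (X i - x) \<le> \<delta>"
proof -
  have "convex hull (range X) \<subseteq> cball (X i) \<delta>"
    using assms(1) by (intro hull_minimal) (auto simp: dist_norm)
  with assms(2) show ?thesis by (auto simp: dist_norm)
qed

text \<open>
  The exact form of the expansion: the third summand measures how far the vertices spread around the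
  interpolation point, and it appears because the weighted mean of the vectors \<open>X i - x0\<close> is \<open>t w\<close>.
\<close>

lemma first_scheme_expansion:
  fixes u :: "real^'n \<Rightarrow> real"
  assumes "invertible (vertex_matrix x0 X)" and "inj X"
    and "x0 + t *\<^sub>R w \<in> convex hull (range X)" and "t > 0"
  defines "b \<equiv> barycentric x0 X (x0 + t *\<^sub>R w)"
  shows "first_scheme u x0 w X t =
    directional S w 1 u x0 + t / 2 * directional S w 2 u x0
    + (\<Sum>i\<in>UNIV. b $ i * directional S (X i - (x0 + t *\<^sub>R w)) 2 u x0) / (2 * t)
    + (\<Sum>i\<in>UNIV. b $ i * quadratic_remainder S u x0 (X i - x0)) / t"
proof -
  define g H where "g = (\<chi> i. partial_within S i u x0)" and "H = hessian_within S u x0"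
  define v where "v = (\<lambda>i. X i - x0)"
  note b = barycentric_convex_hull[OF assms(1-3), folded b_def]
  have v: "(\<Sum>i\<in>UNIV. b $ i *\<^sub>R v i) = t *\<^sub>R w"
    using b(2,3) by (simp add: v_def scaleR_right_diff_distrib sum_subtractf flip: scaleR_left.sum)
  have lin: "(\<Sum>i\<in>UNIV. b $ i * (v i \<bullet> a)) = t * (w \<bullet> a)" for a
    using arg_cong[OF v, of "\<lambda>z. z \<bullet> a"] by (simp add: inner_sum_left)
  have "linear (\<lambda>z. w \<bullet> (H *v z))"
    by (intro linear_compose[OF matrix_vector_mul_linear, unfolded o_def] bounded_linear.linear
        bounded_linear_inner_right)
  then have lin': "(\<Sum>i\<in>UNIV. b $ i * (w \<bullet> (H *v v i))) = t * (w \<bullet> (H *v w))"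
    using arg_cong[OF v, of "\<lambda>z. w \<bullet> (H *v z)"]
      linear_sum[of "\<lambda>z. w \<bullet> (H *v z)" "\<lambda>i. b $ i *\<^sub>R v i" UNIV]
    by (simp add: matrix_vector_mult_scaleR)
  define Q where "Q = (\<Sum>i\<in>UNIV. b $ i * (v i \<bullet> (H *v v i)))"
  have "(v i - t *\<^sub>R w) \<bullet> (H *v (v i - t *\<^sub>R w)) = v i \<bullet> (H *v v i) - t * (v i \<bullet> (H *v w))
      - t * (w \<bullet> (H *v v i)) + t\<^sup>2 * (w \<bullet> (H *v w))" for i
    by (simp add: matrix_vector_mult_diff_distrib matrix_vector_mult_scaleR inner_diff_left
        inner_diff_right power2_eq_square algebra_simps)
  then have "(\<Sum>i\<in>UNIV. b $ i * ((v i - t *\<^sub>R w) \<bullet> (H *v (v i - t *\<^sub>R w))))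
      = Q - t * (\<Sum>i\<in>UNIV. b $ i * (v i \<bullet> (H *v w)))
        - t * (\<Sum>i\<in>UNIV. b $ i * (w \<bullet> (H *v v i))) + (\<Sum>i\<in>UNIV. b $ i) * (t\<^sup>2 * (w \<bullet> (H *v w)))"
    unfolding Q_def sum_distrib_left sum_distrib_right sum_subtractf[symmetric] sum.distrib[symmetric]
    by (intro sum.cong refl) (simp add: algebra_simps)
  also have "\<dots> = Q - t\<^sup>2 * (w \<bullet> (H *v w))"
    unfolding lin lin' b(2) by (simp add: power2_eq_square)
  finally have spread: "(\<Sum>i\<in>UNIV. b $ i * directional S (X i - (x0 + t *\<^sub>R w)) 2 u x0)
      = Q - t\<^sup>2 * (w \<bullet> (H *v w))"
    by (simp only: directional_2 H_def[symmetric] v_def diff_diff_eq)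
  have "(\<Sum>i\<in>UNIV. b $ i * quadratic_remainder S u x0 (X i - x0))
      = (\<Sum>i\<in>UNIV. b $ i * u (X i)) - (\<Sum>i\<in>UNIV. b $ i) * u x0
        - (\<Sum>i\<in>UNIV. b $ i * (v i \<bullet> g)) - Q / 2"
    unfolding Q_def sum_divide_distrib sum_distrib_right sum_subtractf[symmetric]
      quadratic_remainder_def directional_1 directional_2 g_def[symmetric] H_def[symmetric]
    by (intro sum.cong refl) (simp add: algebra_simps v_def)
  then have rem: "(\<Sum>i\<in>UNIV. b $ i * quadratic_remainder S u x0 (X i - x0))
      = interpolant u x0 X (x0 + t *\<^sub>R w) - u x0 - t * (w \<bullet> g) - Q / 2"
    unfolding lin b(2) by (simp add: interpolant_def b_def)
  show ?thesis
    unfolding spread rem unfolding directional_1 directional_2 g_def[symmetric] H_def[symmetric] first_scheme_def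
    using \<open>t > 0\<close> by (simp add: field_simps power2_eq_square)
qed

section \<open>Truncation error in terms of the search radii\<close>

text \<open>
  One factor \<open>1 / a\<close> comes from the first-order schemes and one from the outer factor
  \<open>2 / (tp + tm)\<close>. The Taylor remainders enter through the single bound \<open>\<eta>\<close> on their joint
  contribution, so that cancellation between the two simplices can be exploited where it occurs.
\<close>

lemma second_scheme_error_bound:
  fixes u :: "real^'n \<Rightarrow> real"
  assumes "invertible (vertex_matrix x0 Xp)" and "inj Xp" and "x0 + tp *\<^sub>R w \<in> convex hull (range Xp)"
    and "invertible (vertex_matrix x0 Xm)" and "inj Xm" and "x0 - tm *\<^sub>R w \<in> convex hull (range Xm)"
    and "a > 0" and "a \<le> tp" and "a \<le> tm"
    and "\<And>i j. norm (Xp i - Xp j) \<le> \<delta>" and "\<And>i j. norm (Xm i - Xm j) \<le> \<delta>"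
    and "B \<ge> 0" and "\<And>v. \<bar>directional S v 2 u x0\<bar> \<le> B * norm v ^ 2"
  defines "bp \<equiv> barycentric x0 Xp (x0 + tp *\<^sub>R w)" and "bm \<equiv> barycentric x0 Xm (x0 - tm *\<^sub>R w)"
  assumes "\<bar>(\<Sum>i\<in>UNIV. bp $ i * quadratic_remainder S u x0 (Xp i - x0)) / tp
    + (\<Sum>i\<in>UNIV. bm $ i * quadratic_remainder S u x0 (Xm i - x0)) / tm\<bar> \<le> \<eta>"
  shows "\<bar>second_scheme u x0 w Xp Xm tp tm - w \<bullet> (hessian_within S u x0 *v w)\<bar>
    \<le> (B * \<delta>\<^sup>2 / a + \<eta>) / a"
proof -
  have t: "tp > 0" "tm > 0" using assms(7-9) by auto
  have hullm: "x0 + tm *\<^sub>R (- w) \<in> convex hull (range Xm)" using assms(6) by simp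
  have spread: "\<bar>\<Sum>i\<in>UNIV. barycentric x0 X x $ i * directional S (X i - x) 2 u x0\<bar> \<le> B * \<delta>\<^sup>2"
    if "invertible (vertex_matrix x0 X)" "inj X" "x \<in> convex hull (range X)"
      "\<And>i j. norm (X i - X j) \<le> \<delta>" for X x
  proof (rule weighted_average_bound)
    fix i
    have "norm (X i - x) \<le> \<delta>" using that(4,3) by (rule dist_vertex_convex_hull)
    then have "B * norm (X i - x) ^ 2 \<le> B * \<delta>\<^sup>2"
      using assms(12) by (intro mult_left_mono power_mono) auto
    with assms(13)[of "X i - x"] show "\<bar>directional S (X i - x) 2 u x0\<bar> \<le> B * \<delta>\<^sup>2" by linarith
  qed (use barycentric_convex_hull[OF that(1-3)] in auto)
  define Sp Sm Ep Em where
    "Sp = (\<Sum>i\<in>UNIV. bp $ i * directional S (Xp i - (x0 + tp *\<^sub>R w)) 2 u x0)" and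
    "Sm = (\<Sum>i\<in>UNIV. bm $ i * directional S (Xm i - (x0 - tm *\<^sub>R w)) 2 u x0)" and
    "Ep = (\<Sum>i\<in>UNIV. bp $ i * quadratic_remainder S u x0 (Xp i - x0))" and
    "Em = (\<Sum>i\<in>UNIV. bm $ i * quadratic_remainder S u x0 (Xm i - x0))"
  define Q where "Q = directional S w 2 u x0"
  have S_le: "\<bar>Sp\<bar> \<le> B * \<delta>\<^sup>2" "\<bar>Sm\<bar> \<le> B * \<delta>\<^sup>2"
    unfolding Sp_def Sm_def bp_def bm_def
    using spread[OF assms(1-3,10)] spread[OF assms(4-6,11)] by blast+
  have S_div: "\<bar>s / (2 * t)\<bar> \<le> B * \<delta>\<^sup>2 / (2 * a)" if "\<bar>s\<bar> \<le> B * \<delta>\<^sup>2" "a \<le> t" for s t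
    using that \<open>a > 0\<close> unfolding abs_divide by (intro frac_le) auto
  have "first_scheme u x0 w Xp tp = directional S w 1 u x0 + tp / 2 * Q + Sp / (2 * tp) + Ep / tp"
    unfolding first_scheme_expansion[OF assms(1-3) t(1), where S = S]
    by (simp only: Q_def Sp_def Ep_def bp_def)
  moreover have "first_scheme u x0 (- w) Xm tm
      = - directional S w 1 u x0 + tm / 2 * Q + Sm / (2 * tm) + Em / tm"
    unfolding first_scheme_expansion[OF assms(4,5) hullm t(2), where S = S] directional_minus
    by (simp add: Q_def Sm_def Em_def bm_def del: directional.simps One_nat_def)
  ultimately have "first_scheme u x0 w Xp tp + first_scheme u x0 (- w) Xm tm
      = (tp + tm) / 2 * Q + (Sp / (2 * tp) + Sm / (2 * tm) + (Ep / tp + Em / tm))"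
    by (simp add: add_divide_distrib distrib_right)
  moreover have "2 * (s / 2 * Q + r) / s - Q = 2 * r / s" if "s > 0" for s r
    using that by (simp add: field_simps)
  then have "2 * ((tp + tm) / 2 * Q + r) / (tp + tm) - Q = 2 * r / (tp + tm)" for r
    using t by (simp only: add_pos_pos)
  ultimately have "second_scheme u x0 w Xp Xm tp tm - Q
      = 2 * (Sp / (2 * tp) + Sm / (2 * tm) + (Ep / tp + Em / tm)) / (tp + tm)"
    unfolding second_scheme_def by metis
  also have "\<bar>\<dots>\<bar> = \<bar>Sp / (2 * tp) + Sm / (2 * tm) + (Ep / tp + Em / tm)\<bar> / ((tp + tm) / 2)"
    unfolding abs_divide abs_mult using t by simp
  also have "\<dots> \<le> (B * \<delta>\<^sup>2 / a + \<eta>) / a"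
  proof (rule frac_le)
    have "B * \<delta>\<^sup>2 / a = B * \<delta>\<^sup>2 / (2 * a) + B * \<delta>\<^sup>2 / (2 * a)" by simp
    then show "\<bar>Sp / (2 * tp) + Sm / (2 * tm) + (Ep / tp + Em / tm)\<bar> \<le> B * \<delta>\<^sup>2 / a + \<eta>"
      using S_div[OF S_le(1) assms(8)] S_div[OF S_le(2) assms(9)] assms(16)[folded Ep_def Em_def]
      by linarith
    then show "0 \<le> B * \<delta>\<^sup>2 / a + \<eta>" by linarith
  qed (use assms(7-9) in auto)
  finally show ?thesis by (simp add: Q_def directional_2)
qed

lemma stencil_const_pos: "stencil_const n > 0"
  by (simp add: stencil_const_def add_pos_pos)

text \<open>
  Both radii are of order \<open>h / d\<close>, because \<open>sin (d / 2)\<close> lies between \<open>d / 4\<close> and \<open>d / 2\<close>.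
  The restriction \<open>d \<le> 1\<close> lets the summands \<open>-1\<close> and \<open>+1\<close> in the radii be absorbed.
\<close>

lemma radii_comparable:
  assumes "h > 0" and "0 < d" and "d \<le> 1"
  shows "stencil_const n * h / d \<le> min_radius n h d"
    and "max_radius n h d \<le> 5 * stencil_const n * h / d"
proof -
  have c: "stencil_const n * h > 0"
    using assms(1) by (simp add: stencil_const_pos)
  \<comment> \<open>On \<open>[0, 1/2]\<close> the cosine is at least \<open>cos (\<pi> / 3) = 1/2\<close>, which bounds the sine from below.\<close>
  have "\<exists>z>0. z < d / 2 \<and> sin (d / 2) - sin 0 = (d / 2 - 0) * cos z"
    using assms by (intro MVT2) (auto intro!: derivative_eq_intros)
  then obtain z where z: "0 < z" "z < d / 2" "sin (d / 2) = d / 2 * cos z" by auto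
  have "cos (pi / 3) \<le> cos z"
    using z assms pi_gt3 by (intro cos_monotone_0_pi_le) auto
  then have lo: "d / 4 \<le> sin (d / 2)"
    using assms by (simp add: z(3) cos_60 mult_left_mono[of "1 / 2"])
  have up: "sin (d / 2) \<le> d / 2" using assms by (intro sin_x_le_x) auto
  have "1 / d \<le> - 1 + 2 / d" using assms by (simp add: field_simps)
  also have "2 / d \<le> 1 / sin (d / 2)"
    using lo up assms frac_le[of 1 1 "sin (d / 2)" "d / 2"] by simp
  finally show "stencil_const n * h / d \<le> min_radius n h d"
    using mult_left_mono[of "1 / d" _ "stencil_const n * h"] c by (simp add: min_radius_def)
  have "1 + 1 / sin (d / 2) \<le> 1 + 4 / d"
    using lo assms frac_le[of 1 1 "d / 4" "sin (d / 2)"] by simp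
  also have "\<dots> \<le> 5 / d" using assms by (simp add: field_simps)
  finally show "max_radius n h d \<le> 5 * stencil_const n * h / d"
    using mult_left_mono[of "1 + 1 / sin (d / 2)" "5 / d" "stencil_const n * h"] c
    by (simp add: max_radius_def mult_ac)
qed

lemma symmetric_reindexing:
  fixes Xp Xm :: "'n::finite \<Rightarrow> real^'n"
  assumes "symmetric_simplices x0 Xp Xm" and "inj Xp" and "inj Xm"
  obtains \<pi> where "bij \<pi>" and "\<And>i. Xm (\<pi> i) = 2 *\<^sub>R x0 - Xp i"
proof -
  define \<pi> where "\<pi> = (\<lambda>i. inv Xm (2 *\<^sub>R x0 - Xp i))"
  have eq: "Xm (\<pi> i) = 2 *\<^sub>R x0 - Xp i" for i
    unfolding \<pi>_def using assms(1) by (intro f_inv_into_f) (auto simp: symmetric_simplices_def)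
  have "inj \<pi>"
  proof (rule injI)
    fix i j assume "\<pi> i = \<pi> j"
    then have "Xp i = Xp j" using eq[of i] eq[of j] by simp
    with assms(2) show "i = j" by (simp add: inj_eq)
  qed
  then have "bij \<pi>" by (simp add: bij_def finite_UNIV_inj_surj)
  with eq show thesis by (rule that[rotated])
qed

text \<open>
  Symmetry is a condition on the vertex sets only, so the enumerations of the two simplices may
  differ by a permutation. Reflecting the convex combination for \<open>x0 - tm w\<close> through \<open>x0\<close> writes
  \<open>x0 + tm w\<close> as a convex combination of the vertices of \<open>Xp\<close>; uniqueness of the ray parameter and
  of the barycentric coordinates then identifies it with the one for \<open>x0 + tp w\<close>.
\<close>

lemma symmetric_stencil_coordinates:
  fixes Xp Xm :: "'n::finite \<Rightarrow> real^'n"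
  assumes "invertible (vertex_matrix x0 Xp)" and "inj Xp" and "x0 + tp *\<^sub>R w \<in> convex hull (range Xp)"
    and "invertible (vertex_matrix x0 Xm)" and "inj Xm" and "x0 - tm *\<^sub>R w \<in> convex hull (range Xm)"
    and "symmetric_simplices x0 Xp Xm"
  shows "tp = tm"
    and "(\<Sum>i\<in>UNIV. barycentric x0 Xm (x0 - tm *\<^sub>R w) $ i * f (Xm i - x0))
       = (\<Sum>i\<in>UNIV. barycentric x0 Xp (x0 + tp *\<^sub>R w) $ i * f (- (Xp i - x0)))"
proof -
  obtain \<pi> where \<pi>: "bij \<pi>" "\<And>i. Xm (\<pi> i) = 2 *\<^sub>R x0 - Xp i"
    using symmetric_reindexing[OF assms(7,2,5)] by blast
  define bm where "bm = barycentric x0 Xm (x0 - tm *\<^sub>R w)"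
  note bm = barycentric_convex_hull[OF assms(4-6), folded bm_def]
  define b where "b = (\<chi> i. bm $ \<pi> i)"
  have reindex: "(\<Sum>i\<in>UNIV. F (\<pi> i)) = (\<Sum>i\<in>UNIV. F i)" for F :: "'n \<Rightarrow> 'z::comm_monoid_add"
    using sum.reindex_bij_betw[OF \<pi>(1)] .
  have b1: "(\<Sum>i\<in>UNIV. b $ i) = 1" using reindex[of "\<lambda>i. bm $ i"] bm(2) by (simp add: b_def)
  have Xp: "Xp i = 2 *\<^sub>R x0 - Xm (\<pi> i)" for i using \<pi>(2)[of i] by simp
  have "(\<Sum>i\<in>UNIV. b $ i *\<^sub>R Xp i) = (\<Sum>i\<in>UNIV. bm $ i *\<^sub>R (2 *\<^sub>R x0 - Xm i))"
    unfolding Xp b_def using reindex[of "\<lambda>i. bm $ i *\<^sub>R (2 *\<^sub>R x0 - Xm i)"] by simp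
  also have "\<dots> = (\<Sum>i\<in>UNIV. bm $ i) *\<^sub>R (2 *\<^sub>R x0) - (\<Sum>i\<in>UNIV. bm $ i *\<^sub>R Xm i)"
    by (simp only: scaleR_right_diff_distrib sum_subtractf scaleR_left.sum)
  also have "\<dots> = x0 + tm *\<^sub>R w" by (simp add: bm scaleR_2)
  finally have b2: "(\<Sum>i\<in>UNIV. b $ i *\<^sub>R Xp i) = x0 + tm *\<^sub>R w" .
  have "(\<Sum>i\<in>UNIV. b $ i *\<^sub>R Xp i) \<in> convex hull (range Xp)"
    using b1 bm(1) by (intro convex_sum) (auto simp: b_def hull_inc)
  with b2 assms(3) show tt: "tp = tm"
    by (intro ray_parameter_unique[OF assms(1,2)]) auto
  have "(\<Sum>i\<in>UNIV. b $ i *\<^sub>R (Xp i - x0)) = (x0 + tm *\<^sub>R w) - x0"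
    using b1 b2 by (simp add: scaleR_right_diff_distrib sum_subtractf flip: scaleR_left.sum)
  then have "barycentric x0 Xp (x0 + tp *\<^sub>R w) = b"
    unfolding tt by (rule barycentric_unique[OF assms(1)])
  moreover have "- (Xp i - x0) = Xm (\<pi> i) - x0" for i by (simp add: \<pi>(2) scaleR_2)
  ultimately show "(\<Sum>i\<in>UNIV. bm $ i * f (Xm i - x0))
       = (\<Sum>i\<in>UNIV. barycentric x0 Xp (x0 + tp *\<^sub>R w) $ i * f (- (Xp i - x0)))"
    using reindex[of "\<lambda>i. bm $ i * f (Xm i - x0)"] by (simp only: b_def vec_lambda_beta)
qed

text \<open>
  The bound of \<open>second_scheme_error_bound\<close> for a stencil: the diameter is \<open>2 c h\<close> and the radii are
  at least \<open>c h / d\<close>, so \<open>h\<close> cancels from the spread term.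
\<close>

lemma truncation_error_bound:
  fixes u :: "real^'n \<Rightarrow> real"
  assumes "stencil \<Omega> \<G> h d x0 w Xp Xm tp tm" and "h > 0" and "d \<le> 1" and "convex \<Omega>"
  defines "c \<equiv> stencil_const CARD('n)" and "S \<equiv> closure \<Omega>"
  assumes "B \<ge> 0" and "\<And>v x. x \<in> S \<Longrightarrow> \<bar>directional S v 2 u x\<bar> \<le> B * norm v ^ 2"
  defines "bp \<equiv> barycentric x0 Xp (x0 + tp *\<^sub>R w)" and "bm \<equiv> barycentric x0 Xm (x0 - tm *\<^sub>R w)"
  assumes "\<bar>(\<Sum>i\<in>UNIV. bp $ i * quadratic_remainder S u x0 (Xp i - x0)) / tp
    + (\<Sum>i\<in>UNIV. bm $ i * quadratic_remainder S u x0 (Xm i - x0)) / tm\<bar> \<le> \<eta>"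
  shows "truncation_error \<Omega> u x0 w Xp Xm tp tm \<le> 4 * B * d\<^sup>2 + \<eta> / (c * h / d)"
proof -
  have d: "0 < d" using assms(1) by (simp add: stencil_def)
  have c: "c > 0" by (simp add: c_def stencil_const_pos)
  note r = radii_comparable(1)[OF assms(2) d assms(3), of "CARD('n)", folded c_def]
  have "x0 \<in> S" using assms(1) by (auto simp: stencil_def S_def)
  have "truncation_error \<Omega> u x0 w Xp Xm tp tm \<le> (B * (2 * c * h)\<^sup>2 / (c * h / d) + \<eta>) / (c * h / d)"
    unfolding truncation_error_def S_def[symmetric]
    using assms(1) r c d assms(2,7) assms(8)[OF \<open>x0 \<in> S\<close>] assms(11)[unfolded bp_def bm_def]
    by (intro second_scheme_error_bound) (auto simp: stencil_def admissible_simplex_def c_def)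
  also have "\<dots> = 4 * B * d\<^sup>2 + \<eta> / (c * h / d)"
    using c d assms(2) by (simp add: field_simps power2_eq_square)
  finally show ?thesis .
qed

text \<open>
  Without symmetry the two remainders are estimated separately, each by the cube of the maximal
  radius.
\<close>

lemma general_truncation_error:
  fixes u :: "real^'n \<Rightarrow> real"
  assumes "convex \<Omega>" and "smooth_bounded_on (closure \<Omega>) u"
  shows "\<exists>K\<ge>0. \<forall>\<G> h d x0 w Xp Xm tp tm. h > 0 \<longrightarrow> d \<le> 1 \<longrightarrow>
    stencil \<Omega> \<G> h d x0 w Xp Xm tp tm \<longrightarrow>
    truncation_error \<Omega> u x0 w Xp Xm tp tm \<le> K * (h / d + d\<^sup>2)"
proof -
  define S c where "S = closure \<Omega>" and "c = stencil_const CARD('n)"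
  have S: "convex S" "smooth_bounded_on S u" using assms by (simp_all add: S_def convex_closure)
  have c: "c > 0" by (simp add: c_def stencil_const_pos)
  obtain B2 where B2: "B2 \<ge> 0" "\<And>v x. x \<in> S \<Longrightarrow> \<bar>directional S v 2 u x\<bar> \<le> B2 * norm v ^ 2"
    using directional_bound[of 2 S u] S(2) unfolding smooth_bounded_on_def by blast
  obtain B3 where B3: "B3 \<ge> 0"
    "\<And>x v. x \<in> S \<Longrightarrow> x + v \<in> S \<Longrightarrow> \<bar>quadratic_remainder S u x v\<bar> \<le> B3 * norm v ^ 3"
    using quadratic_remainder_cubic_bound[OF S] by blast
  show ?thesis
    \<comment> \<open>\<open>4 * B2\<close> comes from the diameter \<open>2 c h\<close>, and \<open>250 = 2 * 5\<^sup>3\<close> from two remainders at radius \<open>5 c h / d\<close>.\<close>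
  proof (intro exI[of _ "4 * B2 + 250 * B3 * c"] conjI allI impI)
    fix \<G> h d x0 w Xp Xm tp tm
    assume h: "h > (0::real)" and "d \<le> 1" and st: "stencil \<Omega> \<G> h d x0 w Xp Xm tp tm"
    then have d: "0 < d" by (simp add: stencil_def)
    define \<rho> where "\<rho> = h / d"
    have \<rho>: "\<rho> > 0" using h d by (simp add: \<rho>_def)
    have r: "c * \<rho> \<le> min_radius CARD('n) h d" "max_radius CARD('n) h d \<le> 5 * c * \<rho>"
      using radii_comparable[OF h d \<open>d \<le> 1\<close>, of "CARD('n)"] by (simp_all add: c_def \<rho>_def)
    have E: "\<bar>(\<Sum>i\<in>UNIV. barycentric x0 X (x0 + t *\<^sub>R v) $ i * quadratic_remainder S u x0 (X i - x0)) / t\<bar>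
        \<le> B3 * (5 * c * \<rho>) ^ 3 / (c * \<rho>)"
      if X: "admissible_simplex \<G> h d x0 X" and hull: "x0 + t *\<^sub>R v \<in> convex hull (range X)"
        and t: "min_radius CARD('n) h d \<le> t" for X t v
    proof -
      note b = barycentric_convex_hull[OF _ _ hull, of x0]
      have "\<bar>\<Sum>i\<in>UNIV. barycentric x0 X (x0 + t *\<^sub>R v) $ i * quadratic_remainder S u x0 (X i - x0)\<bar>
        \<le> B3 * (5 * c * \<rho>) ^ 3"
      proof (rule weighted_average_bound)
        fix i
        have "norm (X i - x0) \<le> 5 * c * \<rho>" "X i \<in> S" "x0 \<in> S"
          using X st r(2) by (auto simp: admissible_simplex_def stencil_def S_def intro: order_trans)
        then have "\<bar>quadratic_remainder S u x0 (X i - x0)\<bar> \<le> B3 * norm (X i - x0) ^ 3"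
          "B3 * norm (X i - x0) ^ 3 \<le> B3 * (5 * c * \<rho>) ^ 3"
          using B3 by (auto intro!: mult_left_mono power_mono)
        then show "\<bar>quadratic_remainder S u x0 (X i - x0)\<bar> \<le> B3 * (5 * c * \<rho>) ^ 3" by linarith
      qed (use b X in \<open>auto simp: admissible_simplex_def\<close>)
      then show ?thesis
        unfolding abs_divide using c \<rho> r(1) t by (intro frac_le) auto
    qed
    have "truncation_error \<Omega> u x0 w Xp Xm tp tm
        \<le> 4 * B2 * d\<^sup>2 + 2 * (B3 * (5 * c * \<rho>) ^ 3 / (c * \<rho>)) / (c * h / d)"
    proof (rule truncation_error_bound[OF st h \<open>d \<le> 1\<close> assms(1), folded S_def c_def, OF B2])
      let ?e = "\<lambda>X x t. (\<Sum>i\<in>UNIV. barycentric x0 X x $ i * quadratic_remainder S u x0 (X i - x0)) / t"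
      have "\<bar>?e Xp (x0 + tp *\<^sub>R w) tp\<bar> \<le> B3 * (5 * c * \<rho>) ^ 3 / (c * \<rho>)"
        using st by (intro E) (auto simp: stencil_def)
      moreover have "\<bar>?e Xm (x0 - tm *\<^sub>R w) tm\<bar> \<le> B3 * (5 * c * \<rho>) ^ 3 / (c * \<rho>)"
        using E[of Xm tm "- w"] st by (auto simp: stencil_def)
      ultimately show "\<bar>?e Xp (x0 + tp *\<^sub>R w) tp + ?e Xm (x0 - tm *\<^sub>R w) tm\<bar>
          \<le> 2 * (B3 * (5 * c * \<rho>) ^ 3 / (c * \<rho>))"
        by linarith
    qed
    also have "\<dots> = 4 * B2 * d\<^sup>2 + 250 * B3 * c * \<rho>"
      using c \<rho> by (simp add: \<rho>_def[symmetric] times_divide_eq_right[symmetric] del: times_divide_eq_right)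
        (simp add: field_simps power_mult_distrib power3_eq_cube)
    also have "\<dots> \<le> (4 * B2 + 250 * B3 * c) * (\<rho> + d\<^sup>2)"
      using B2(1) B3(1) c \<rho> by (simp add: algebra_simps)
    finally show "truncation_error \<Omega> u x0 w Xp Xm tp tm \<le> (4 * B2 + 250 * B3 * c) * (h / d + d\<^sup>2)"
      by (simp add: \<rho>_def)
  qed (use B2(1) B3(1) c in simp)
qed

text \<open>
  On a symmetric stencil the two remainder sums merge into one sum of even parts, which is of fourth
  order in the maximal radius.
\<close>

lemma symmetric_truncation_error:
  fixes u :: "real^'n \<Rightarrow> real"
  assumes "convex \<Omega>" and "smooth_bounded_on (closure \<Omega>) u"
  shows "\<exists>K\<ge>0. \<forall>\<G> h d x0 w Xp Xm tp tm. h > 0 \<longrightarrow> d \<le> 1 \<longrightarrow>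
    stencil \<Omega> \<G> h d x0 w Xp Xm tp tm \<longrightarrow> symmetric_simplices x0 Xp Xm \<longrightarrow>
    truncation_error \<Omega> u x0 w Xp Xm tp tm \<le> K * ((h / d)\<^sup>2 + d\<^sup>2)"
proof -
  define S c where "S = closure \<Omega>" and "c = stencil_const CARD('n)"
  have S: "convex S" "smooth_bounded_on S u" using assms by (simp_all add: S_def convex_closure)
  have c: "c > 0" by (simp add: c_def stencil_const_pos)
  obtain B2 where B2: "B2 \<ge> 0" "\<And>v x. x \<in> S \<Longrightarrow> \<bar>directional S v 2 u x\<bar> \<le> B2 * norm v ^ 2"
    using directional_bound[of 2 S u] S(2) unfolding smooth_bounded_on_def by blast
  obtain B4 where B4: "B4 \<ge> 0"
    "\<And>x v. x \<in> S \<Longrightarrow> x + v \<in> S \<Longrightarrow> x - v \<in> S \<Longrightarrow>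
      \<bar>quadratic_remainder S u x v + quadratic_remainder S u x (- v)\<bar> \<le> B4 * norm v ^ 4"
    using quadratic_remainder_even_bound[OF S] by blast
  show ?thesis
    \<comment> \<open>\<open>625 = 5\<^sup>4\<close> comes from one even part at radius \<open>5 c h / d\<close>.\<close>
  proof (intro exI[of _ "4 * B2 + 625 * B4 * c\<^sup>2"] conjI allI impI)
    fix \<G> h d x0 w Xp Xm tp tm
    assume h: "h > (0::real)" and "d \<le> 1" and st: "stencil \<Omega> \<G> h d x0 w Xp Xm tp tm"
      and sym: "symmetric_simplices x0 Xp Xm"
    then have d: "0 < d" by (simp add: stencil_def)
    define \<rho> where "\<rho> = h / d"
    have \<rho>: "\<rho> > 0" using h d by (simp add: \<rho>_def)
    have r: "c * \<rho> \<le> min_radius CARD('n) h d" "max_radius CARD('n) h d \<le> 5 * c * \<rho>"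
      using radii_comparable[OF h d \<open>d \<le> 1\<close>, of "CARD('n)"] by (simp_all add: c_def \<rho>_def)
    have simplices: "invertible (vertex_matrix x0 Xp)" "inj Xp" "x0 + tp *\<^sub>R w \<in> convex hull (range Xp)"
      "invertible (vertex_matrix x0 Xm)" "inj Xm" "x0 - tm *\<^sub>R w \<in> convex hull (range Xm)"
      using st by (auto simp: stencil_def admissible_simplex_def)
    let ?bp = "barycentric x0 Xp (x0 + tp *\<^sub>R w)" and ?bm = "barycentric x0 Xm (x0 - tm *\<^sub>R w)"
    let ?q = "quadratic_remainder S u x0"
    note symmetric = symmetric_stencil_coordinates[OF simplices sym]
    have "\<bar>\<Sum>i\<in>UNIV. ?bp $ i * (?q (Xp i - x0) + ?q (- (Xp i - x0)))\<bar> \<le> B4 * (5 * c * \<rho>) ^ 4"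
    proof (rule weighted_average_bound)
      fix i
      have "norm (Xp i - x0) \<le> 5 * c * \<rho>" "Xp i \<in> S" "x0 \<in> S"
        using st r(2) by (auto simp: admissible_simplex_def stencil_def S_def intro: order_trans)
      moreover have "2 *\<^sub>R x0 - Xp i \<in> range Xm" using sym by (auto simp: symmetric_simplices_def)
      then have "2 *\<^sub>R x0 - Xp i \<in> S"
        using st by (auto simp: admissible_simplex_def stencil_def S_def)
      then have "x0 - (Xp i - x0) \<in> S" by (simp add: scaleR_2 algebra_simps)
      ultimately have "\<bar>?q (Xp i - x0) + ?q (- (Xp i - x0))\<bar> \<le> B4 * norm (Xp i - x0) ^ 4"
        "B4 * norm (Xp i - x0) ^ 4 \<le> B4 * (5 * c * \<rho>) ^ 4"
        using B4(1) B4(2)[of x0 "Xp i - x0"] by (auto intro!: mult_left_mono power_mono)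
      then show "\<bar>?q (Xp i - x0) + ?q (- (Xp i - x0))\<bar> \<le> B4 * (5 * c * \<rho>) ^ 4" by linarith
    qed (use barycentric_convex_hull[OF simplices(1-3)] in auto)
    then have "\<bar>(\<Sum>i\<in>UNIV. ?bp $ i * (?q (Xp i - x0) + ?q (- (Xp i - x0)))) / tp\<bar>
        \<le> B4 * (5 * c * \<rho>) ^ 4 / (c * \<rho>)"
      unfolding abs_divide using c \<rho> r(1) st by (intro frac_le) (auto simp: stencil_def)
    then have rem: "\<bar>(\<Sum>i\<in>UNIV. ?bp $ i * ?q (Xp i - x0)) / tp + (\<Sum>i\<in>UNIV. ?bm $ i * ?q (Xm i - x0)) / tm\<bar>
        \<le> B4 * (5 * c * \<rho>) ^ 4 / (c * \<rho>)"
      unfolding symmetric(2)[of ?q] unfolding symmetric(1)[symmetric]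
      by (simp only: distrib_left sum.distrib add_divide_distrib)
    have "truncation_error \<Omega> u x0 w Xp Xm tp tm
        \<le> 4 * B2 * d\<^sup>2 + (B4 * (5 * c * \<rho>) ^ 4 / (c * \<rho>)) / (c * h / d)"
      by (rule truncation_error_bound[OF st h \<open>d \<le> 1\<close> assms(1), folded S_def c_def, OF B2 rem])
    also have "\<dots> = 4 * B2 * d\<^sup>2 + 625 * B4 * c\<^sup>2 * \<rho>\<^sup>2"
      using c \<rho> by (simp add: \<rho>_def[symmetric] times_divide_eq_right[symmetric] del: times_divide_eq_right)
        (simp add: field_simps power_mult_distrib eval_nat_numeral)
    also have "\<dots> \<le> (4 * B2 + 625 * B4 * c\<^sup>2) * (\<rho>\<^sup>2 + d\<^sup>2)"
      using B2(1) B4(1) by (simp add: algebra_simps)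
    finally show "truncation_error \<Omega> u x0 w Xp Xm tp tm
        \<le> (4 * B2 + 625 * B4 * c\<^sup>2) * ((h / d)\<^sup>2 + d\<^sup>2)"
      by (simp add: \<rho>_def)
  qed (use B2(1) B4(1) in simp)
qed

section \<open>Optimal angular resolutions and the resulting rates\<close>

lemma consistent_if_uniformly_bigo:
  assumes "uniformly_bigo E g" and "(g \<longlongrightarrow> 0) (at_right 0)"
  shows "consistent E"
  unfolding consistent_def
proof (intro allI impI)
  fix \<epsilon> :: real assume "\<epsilon> > 0"
  obtain C where C: "\<forall>\<^sub>F h in at_right 0. \<forall>e\<in>E h. e \<le> C * g h"
    using assms(1) by (auto simp: uniformly_bigo_def)
  have "((\<lambda>h. C * g h) \<longlongrightarrow> C * 0) (at_right 0)"
    using assms(2) by (intro tendsto_intros)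
  then have "\<forall>\<^sub>F h in at_right 0. C * g h < \<epsilon>"
    using \<open>\<epsilon> > 0\<close> by (simp add: order_tendstoD)
  with C show "\<forall>\<^sub>F h in at_right 0. \<forall>e\<in>E h. e < \<epsilon>"
    by eventually_elim fastforce
qed

lemma cube_root_arg_min:
  fixes h :: real
  assumes "h > 0"
  shows "is_arg_min (\<lambda>d. h / d + d\<^sup>2) (\<lambda>d. d > 0) ((h / 2) powr (1/3))"
proof -
  define a where "a = (h / 2) powr (1/3)"
  have a: "a > 0" using assms by (simp add: a_def)
  have "a ^ 3 = h / 2" using assms by (simp add: a_def powr_power)
  then have h: "h = 2 * a ^ 3" by simp
  have "h / a + a\<^sup>2 \<le> h / d + d\<^sup>2" if "d > 0" for d
  proof -
    \<comment> \<open>With \<open>h = 2 a\<^sup>3\<close> the numerator \<open>d\<^sup>3 - 3 a\<^sup>2 d + 2 a\<^sup>3\<close> has the double root \<open>a\<close>.\<close>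
    have "h / d + d\<^sup>2 - (h / a + a\<^sup>2) = (d - a)\<^sup>2 * (d + 2 * a) / d"
      using a that unfolding h by (simp add: field_simps power2_eq_square power3_eq_cube)
    also have "\<dots> \<ge> 0" using a that by simp
    finally show ?thesis by simp
  qed
  with a show ?thesis unfolding a_def[symmetric] is_arg_min_def by (meson leD)
qed

lemma square_root_arg_min:
  fixes h :: real
  assumes "h > 0"
  shows "is_arg_min (\<lambda>d. (h / d)\<^sup>2 + d\<^sup>2) (\<lambda>d. d > 0) (h powr (1/2))"
proof -
  define a where "a = h powr (1/2)"
  have a: "a > 0" using assms by (simp add: a_def)
  have h: "h = a\<^sup>2" using assms by (simp add: a_def powr_power)
  have "(h / a)\<^sup>2 + a\<^sup>2 \<le> (h / d)\<^sup>2 + d\<^sup>2" if "d > 0" for d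
  proof -
    have "(h / d)\<^sup>2 + d\<^sup>2 - ((h / a)\<^sup>2 + a\<^sup>2) = (h / d - d)\<^sup>2"
      using a that unfolding h by (simp add: field_simps power2_eq_square)
    then show ?thesis using zero_le_power2[of "h / d - d"] by linarith
  qed
  with a show ?thesis unfolding a_def[symmetric] is_arg_min_def by (meson leD)
qed

lemma general_rate:
  fixes u :: "real^'n \<Rightarrow> real"
  assumes "convex \<Omega>" and "smooth_bounded_on (closure \<Omega>) u"
  shows "uniformly_bigo (general_errors \<Omega> u (\<lambda>h. (h / 2) powr (1/3))) (\<lambda>h. h powr (2/3))"
proof -
  obtain K where K: "K \<ge> 0" and err: "\<And>\<G> h d x0 w Xp Xm tp tm. h > 0 \<Longrightarrow> d \<le> 1 \<Longrightarrow>
    stencil \<Omega> \<G> h d x0 w Xp Xm tp tm \<Longrightarrow>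
    truncation_error \<Omega> u x0 w Xp Xm tp tm \<le> K * (h / d + d\<^sup>2)"
    using general_truncation_error[OF assms] by blast
  have "\<forall>e\<in>general_errors \<Omega> u (\<lambda>h. (h / 2) powr (1/3)) h. e \<le> 3 * K * h powr (2/3)"
    if h: "0 < h" "h < 1" for h
  proof -
    define d where "d = (h / 2) powr (1/3)"
    have d: "d > 0" using h by (simp add: d_def)
    have "d \<le> 1" unfolding d_def using h by (intro powr_le1) auto
    have "d ^ 3 = h / 2" using h by (simp add: d_def powr_power)
    then have "h / d = 2 * d\<^sup>2" using d by (simp add: field_simps power2_eq_square power3_eq_cube)
    moreover have "d\<^sup>2 \<le> h powr (2/3)"
      using h by (simp add: d_def powr_power powr_mono2)
    ultimately have bound: "K * (h / d + d\<^sup>2) \<le> 3 * K * h powr (2/3)"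
      using K by (simp add: mult_left_mono)
    then show ?thesis
      using order_trans[OF err[OF h(1) \<open>d \<le> 1\<close>] bound]
      by (auto simp: general_errors_def d_def[symmetric])
  qed
  then show ?thesis
    unfolding uniformly_bigo_def
    by (intro exI[of _ "3 * K"]) (auto simp: eventually_at_right_field intro!: exI[of _ 1])
qed

lemma symmetric_rate:
  fixes u :: "real^'n \<Rightarrow> real"
  assumes "convex \<Omega>" and "smooth_bounded_on (closure \<Omega>) u"
  shows "uniformly_bigo (symmetric_errors \<Omega> u (\<lambda>h. h powr (1/2))) (\<lambda>h. h)"
proof -
  obtain K where K: "K \<ge> 0" and err: "\<And>\<G> h d x0 w Xp Xm tp tm. h > 0 \<Longrightarrow> d \<le> 1 \<Longrightarrow>
    stencil \<Omega> \<G> h d x0 w Xp Xm tp tm \<Longrightarrow> symmetric_simplices x0 Xp Xm \<Longrightarrow>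
    truncation_error \<Omega> u x0 w Xp Xm tp tm \<le> K * ((h / d)\<^sup>2 + d\<^sup>2)"
    using symmetric_truncation_error[OF assms] by blast
  have "\<forall>e\<in>symmetric_errors \<Omega> u (\<lambda>h. h powr (1/2)) h. e \<le> 2 * K * h"
    if h: "0 < h" "h < 1" for h
  proof -
    define d where "d = h powr (1/2)"
    have d: "d > 0" using h by (simp add: d_def)
    have "d \<le> 1" unfolding d_def using h by (intro powr_le1) auto
    have "d\<^sup>2 = h" using h by (simp add: d_def powr_power)
    then have bound: "K * ((h / d)\<^sup>2 + d\<^sup>2) \<le> 2 * K * h"
      using d by (simp add: field_simps power2_eq_square)
    then show ?thesis
      using order_trans[OF err[OF h(1) \<open>d \<le> 1\<close>] bound]
      by (auto simp: symmetric_errors_def d_def[symmetric])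
  qed
  then show ?thesis
    unfolding uniformly_bigo_def
    by (intro exI[of _ "2 * K"]) (auto simp: eventually_at_right_field intro!: exI[of _ 1])
qed

theorem lemma6:
  fixes \<Omega> :: "(real^'n) set" and u :: "real^'n \<Rightarrow> real"
  assumes "CARD('n) \<in> {2, 3}"
    and "open \<Omega>" and "convex \<Omega>" and "bounded \<Omega>" and "\<Omega> \<noteq> {}"
    and "lipschitz_boundary \<Omega>"
    and "smooth_bounded_on (closure \<Omega>) u"
  shows "((\<forall>h::real>0. is_arg_min (\<lambda>d\<theta>::real. h / d\<theta> + d\<theta>^2) (\<lambda>d\<theta>. d\<theta> > 0) ((h / 2) powr (1/3))) \<and>
          consistent (general_errors \<Omega> u (\<lambda>h. (h / 2) powr (1/3))) \<and>
          uniformly_bigo (general_errors \<Omega> u (\<lambda>h. (h / 2) powr (1/3))) (\<lambda>h. h powr (2/3))) \<and>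
         ((\<forall>h::real>0. is_arg_min (\<lambda>d\<theta>::real. (h / d\<theta>)^2 + d\<theta>^2) (\<lambda>d\<theta>. d\<theta> > 0) (h powr (1/2))) \<and>
          consistent (symmetric_errors \<Omega> u (\<lambda>h. h powr (1/2))) \<and>
          uniformly_bigo (symmetric_errors \<Omega> u (\<lambda>h. h powr (1/2))) (\<lambda>h. h))"
proof -
  have "((\<lambda>h::real. h powr (2/3)) \<longlongrightarrow> 0 powr (2/3)) (at_right 0)"
    by (rule tendsto_powr') (auto simp: eventually_at_right_field intro!: exI[of _ 1])
  then have "consistent (general_errors \<Omega> u (\<lambda>h. (h / 2) powr (1/3)))"
    using general_rate[OF assms(3,7)] by (intro consistent_if_uniformly_bigo) auto
  moreover have "consistent (symmetric_errors \<Omega> u (\<lambda>h. h powr (1/2)))"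
    using symmetric_rate[OF assms(3,7)] by (rule consistent_if_uniformly_bigo) (rule tendsto_ident_at)
  ultimately show ?thesis
    using general_rate[OF assms(3,7)] symmetric_rate[OF assms(3,7)]
      cube_root_arg_min square_root_arg_min by blast
qed

end
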